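(* Let $D$ be a bounded domain in $\mathbb{C}$ and $x\in D$. Then the Carathéodory pseudo-norm of $\frac{\partial}{\partial z}$ at $x$ is not less than $\dfrac{s_D(x)}{4\delta(x)}$, where $z$ is the standard coordinate on $\mathbb{C}$ and $\frac{\partial}{\partial z}$ is viewed as a vector in the tangent space $T_xD$ of $D$ at $x$.
   Context: $\Delta\subset\mathbb{C}$ is the open unit disc and $\Delta_r$ the open disc with center $0$ and radius $r$. For a bounded domain $D\subset\mathbb{C}$ and $p\in D$, the squeezing function is $s_D(p)=\sup_f\,\sup\{r:\Delta_r\subset f(D)\}$, where the outer supremum is over all injective holomorphic maps $f:D\to\Delta$ with $f(p)=0$. $\delta(x)$ is the Euclidean distance from $x$ to the boundary $\partial D$. The Carathéodory pseudo-norm of $\frac{\partial}{\partial z}$ at $x$ is $\sup\{|f'(x)| : f:D\to\Delta \text{ holomorphic},\ f(x)=0\}$. *)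

theory Defs
  imports "HOL-Complex_Analysis.Complex_Analysis"
begin

definition disc_maps :: "complex set \<Rightarrow> complex \<Rightarrow> (complex \<Rightarrow> complex) set" where
  "disc_maps D p = {f. f holomorphic_on D \<and> f ` D \<subseteq> ball 0 1 \<and> f p = 0}"

text \<open>
  Both suprema below are taken in the reals.  For a bounded domain \<open>D\<close> and \<open>p \<in> D\<close> they are
  suprema of nonempty sets that are bounded above: the radii are at most \<open>1\<close>, since
  \<open>f ` D\<close> lies in the unit disc (any \<open>r \<le> 0\<close> gives the empty disc and does not affect the
  supremum), and a scaled translation is an admissible injective map.
\<close>

definition squeezing :: "complex set \<Rightarrow> complex \<Rightarrow> real" where
  "squeezing D p = (SUP f \<in> {f \<in> disc_maps D p. inj_on f D}. Sup {r. ball 0 r \<subseteq> f ` D})"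

text \<open>
  The Caratheodory pseudo-norm of the coordinate vector \<open>\<partial>/\<partial>z\<close> at \<open>x\<close>.  For \<open>D\<close> open and
  \<open>x \<in> D\<close> the supremum is over a nonempty set, bounded above by Cauchy's estimate.
\<close>

definition caratheodory_norm :: "complex set \<Rightarrow> complex \<Rightarrow> real" where
  "caratheodory_norm D x = (SUP f \<in> disc_maps D x. cmod (deriv f x))"

end

theory Submission
  imports Defs
begin

text \<open>
  Suppose an injective \<open>f : D \<rightarrow> \<Delta>\<close> with \<open>f x = 0\<close> satisfies \<open>\<Delta>\<^sub>r \<subseteq> f(D)\<close>, and let \<open>w\<close> be a boundary point
  nearest to \<open>x\<close>. The map \<open>z \<mapsto> f\<^sup>-\<^sup>1(r z) - w\<close> is injective and zero-free on the unit disc, so the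
  Koebe quarter theorem bounds its derivative \<open>r / f'(x)\<close> at \<open>0\<close> by \<open>4 \<delta>(x)\<close>, and \<open>f\<close> itself is
  a competitor for the Caratheodory norm.

  The quarter theorem is obtained from the positivity of logarithmic energy instead of the area
  theorem. A zero-free injective \<open>g\<close> has a square root \<open>h\<close> whose image is disjoint from its
  negative, and the claim becomes \<open>|h'(0)| \<le> 2 |h(0)|\<close>. Put charges \<open>+1\<close> at \<open>h(r \<omega>)\<close> and \<open>-1\<close> at
  \<open>-h(r \<omega>)\<close>, where \<open>\<omega>\<close> runs over the \<open>n\<close>-th roots of unity. Positivity of the regularised energy
  of this neutral system bounds the double mean over \<open>z \<noteq> w\<close> of
  \<open>ln |(h z - h w) / (h z + h w)|\<close> by \<open>o(1)\<close>. Dividing out \<open>z - w\<close>, whose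
  double mean is \<open>ln r + o(1)\<close>, leaves the logarithm of the modulus of a zero-free function that is
  holomorphic in each variable, and its double mean tends to the value at the centre,
  \<open>ln |h'(0) / (2 h(0))|\<close>.
\<close>

subsection \<open>Positivity of the logarithmic energy\<close>

text \<open>Schur product argument: expanding one factor of the inner product in an orthonormal
  basis gives, for each \<open>b\<close>, a form of degree \<open>n\<close> with coefficients
  \<open>c i * (\<phi> i \<bullet> b)\<close>. The induction therefore has to run over all
  \<open>c\<close>.\<close>

lemma inner_power_psd:
  fixes \<phi> :: "'a \<Rightarrow> 'b :: euclidean_space"
  shows "(\<Sum>i\<in>I. \<Sum>j\<in>I. c i * c j * (\<phi> i \<bullet> \<phi> j) ^ n) \<ge> 0"
proof (induction n arbitrary: c)
  case 0
  have "(\<Sum>i\<in>I. \<Sum>j\<in>I. c i * c j) = (\<Sum>i\<in>I. c i)\<^sup>2"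
    by (simp add: power2_eq_square sum_product)
  then show ?case by simp
next
  case (Suc n)
  have "(\<Sum>i\<in>I. \<Sum>j\<in>I. c i * c j * (\<phi> i \<bullet> \<phi> j) ^ Suc n)
      = (\<Sum>i\<in>I. \<Sum>j\<in>I. \<Sum>b\<in>Basis. (c i * (\<phi> i \<bullet> b)) * (c j * (\<phi> j \<bullet> b)) * (\<phi> i \<bullet> \<phi> j) ^ n)"
  proof (intro sum.cong refl)
    fix i j
    have "c i * c j * (\<phi> i \<bullet> \<phi> j) ^ Suc n
        = c i * c j * (\<phi> i \<bullet> \<phi> j) ^ n * (\<Sum>b\<in>Basis. (\<phi> i \<bullet> b) * (\<phi> j \<bullet> b))"
      by (simp flip: euclidean_inner)
    also have "\<dots> = (\<Sum>b\<in>Basis. (c i * (\<phi> i \<bullet> b)) * (c j * (\<phi> j \<bullet> b)) * (\<phi> i \<bullet> \<phi> j) ^ n)"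
      unfolding sum_distrib_left by (intro sum.cong refl) (simp only: mult_ac)
    finally show "c i * c j * (\<phi> i \<bullet> \<phi> j) ^ Suc n = \<dots>" .
  qed
  also have "\<dots> = (\<Sum>b\<in>Basis. \<Sum>i\<in>I. \<Sum>j\<in>I.
      (c i * (\<phi> i \<bullet> b)) * (c j * (\<phi> j \<bullet> b)) * (\<phi> i \<bullet> \<phi> j) ^ n)"
    by (simp only: sum.swap[of _ Basis])
  also have "\<dots> \<ge> 0"
    by (intro sum_nonneg Suc.IH)
  finally show ?case .
qed

text \<open>\<open>- ln (1 - u)\<close> is a power series with nonnegative coefficients, so the form
  is a limit of negated positive semidefinite ones.\<close>

lemma ln_one_minus_inner_nsd:
  fixes \<phi> :: "'a \<Rightarrow> 'b :: euclidean_space"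
  assumes "\<And>i. i \<in> I \<Longrightarrow> norm (\<phi> i) < 1"
  shows "(\<Sum>i\<in>I. \<Sum>j\<in>I. c i * c j * ln (1 - \<phi> i \<bullet> \<phi> j)) \<le> 0"
proof -
  have u: "\<bar>\<phi> i \<bullet> \<phi> j\<bar> < 1" if "i \<in> I" "j \<in> I" for i j
  proof -
    have "\<bar>\<phi> i \<bullet> \<phi> j\<bar> \<le> norm (\<phi> i) * norm (\<phi> j)" by (rule Cauchy_Schwarz_ineq2)
    also have "\<dots> < 1 * 1" using assms that by (intro mult_strict_mono') auto
    finally show ?thesis by simp
  qed
  \<comment> \<open>The term \<open>n = 0\<close> is zero by the convention for division by zero, so
    the series effectively starts at \<open>n = 1\<close>.\<close>
  have "(\<lambda>n. \<Sum>i\<in>I. \<Sum>j\<in>I. c i * c j * - ((\<phi> i \<bullet> \<phi> j) ^ n / real n)) sums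
        (\<Sum>i\<in>I. \<Sum>j\<in>I. c i * c j * ln (1 - \<phi> i \<bullet> \<phi> j))"
  proof (intro sums_sum sums_mult)
    fix i j assume "i \<in> I" "j \<in> I"
    from ln_series'[of "- (\<phi> i \<bullet> \<phi> j)"] u[OF this]
    show "(\<lambda>n. - ((\<phi> i \<bullet> \<phi> j) ^ n / real n)) sums ln (1 - \<phi> i \<bullet> \<phi> j)" by simp
  qed
  moreover have "(\<Sum>i\<in>I. \<Sum>j\<in>I. c i * c j * - ((\<phi> i \<bullet> \<phi> j) ^ n / real n)) \<le> 0" for n
  proof -
    have "(\<Sum>i\<in>I. \<Sum>j\<in>I. c i * c j * - ((\<phi> i \<bullet> \<phi> j) ^ n / real n))
        = - ((\<Sum>i\<in>I. \<Sum>j\<in>I. c i * c j * (\<phi> i \<bullet> \<phi> j) ^ n) / real n)"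
      by (simp add: sum_divide_distrib sum_negf)
    then show ?thesis using inner_power_psd[of c \<phi> n I] by simp
  qed
  ultimately show ?thesis
    by (rule sums_le[OF _ _ sums_zero, rotated])
qed

text \<open>
  Inverse stereographic projection of the \<open>p i\<close>, scaled into the open ball by \<open>\<epsilon>\<close>, turns
  \<open>|p i - p j|\<^sup>2 + \<epsilon>\<close> into \<open>1 - \<phi> i \<bullet> \<phi> j\<close> up to factors depending on \<open>i\<close> or \<open>j\<close> alone, which do
  not contribute for neutral charges.
\<close>

lemma log_energy_nonpos:
  fixes p :: "'a \<Rightarrow> complex"
  assumes "0 < \<epsilon>" "\<epsilon> \<le> 1" and c: "sum c I = 0"
  shows "(\<Sum>i\<in>I. \<Sum>j\<in>I. c i * c j * ln ((cmod (p i - p j))\<^sup>2 + \<epsilon>)) \<le> 0"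
proof -
  define a where "a i = 1 + (cmod (p i))\<^sup>2" for i
  \<comment> \<open>For \<epsilon> = 0 these would be unit vectors. Shrinking the second coordinate
    by \<open>sqrt (1 - \<epsilon>)\<close> subtracts exactly
    \<open>\<epsilon> / (a i * a j)\<close> from each inner product, which is the
    regularisation.\<close>
  define \<phi> where "\<phi> i = (complex_of_real ((cmod (p i))\<^sup>2 / a i) + \<i> * complex_of_real (sqrt (1 - \<epsilon>) / a i),
    (sqrt 2 / a i) *\<^sub>R p i)" for i
  have a: "a i \<ge> 1" for i by (simp add: a_def)
  then have a0: "a i > 0" "a i \<noteq> 0" for i by (smt (verit))+
  have inner: "\<phi> i \<bullet> \<phi> j = ((cmod (p i))\<^sup>2 * (cmod (p j))\<^sup>2 + (1 - \<epsilon>) + 2 * (p i \<bullet> p j)) / (a i * a j)" for i j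
    using assms a0 by (simp add: \<phi>_def inner_complex_def field_simps)
  have eq: "1 - \<phi> i \<bullet> \<phi> j = ((cmod (p i - p j))\<^sup>2 + \<epsilon>) / (a i * a j)" for i j
  proof -
    have "(cmod (p i - p j))\<^sup>2 = (cmod (p i))\<^sup>2 + (cmod (p j))\<^sup>2 - 2 * (p i \<bullet> p j)"
      by (simp add: power2_norm_eq_inner inner_diff inner_commute algebra_simps)
    then show ?thesis
      unfolding inner using a0[of i] a0[of j]
      by (simp add: field_simps) (simp add: a_def algebra_simps)
  qed
  have nrm: "norm (\<phi> i) < 1" for i
  proof -
    have "1 - \<phi> i \<bullet> \<phi> i > 0" unfolding eq using a0 assms by simp
    then have "(norm (\<phi> i))\<^sup>2 < 1\<^sup>2" by (simp add: power2_norm_eq_inner)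
    then show ?thesis by (rule power_less_imp_less_base) simp
  qed
  have "ln ((cmod (p i - p j))\<^sup>2 + \<epsilon>) = ln (1 - \<phi> i \<bullet> \<phi> j) + ln (a i) + ln (a j)" for i j
  proof -
    have "(cmod (p i - p j))\<^sup>2 + \<epsilon> > 0" using assms(1) by (simp add: add_nonneg_pos)
    then show ?thesis unfolding eq using a0 by (simp add: ln_div ln_mult)
  qed
  then have "(\<Sum>i\<in>I. \<Sum>j\<in>I. c i * c j * ln ((cmod (p i - p j))\<^sup>2 + \<epsilon>))
     = (\<Sum>i\<in>I. \<Sum>j\<in>I. c i * c j * ln (1 - \<phi> i \<bullet> \<phi> j) + (c i * ln (a i)) * c j + c i * (c j * ln (a j)))"
    by (simp only: distrib_left mult_ac)
  also have "\<dots> = (\<Sum>i\<in>I. \<Sum>j\<in>I. c i * c j * ln (1 - \<phi> i \<bullet> \<phi> j)) + (\<Sum>i\<in>I. c i * ln (a i)) * sum c I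
       + sum c I * (\<Sum>i\<in>I. c i * ln (a i))"
    by (simp only: sum_product sum.distrib)
  also have "\<dots> \<le> 0" using ln_one_minus_inner_nsd[of I \<phi> c] nrm c by simp
  finally show ?thesis .
qed

text \<open>Charge \<open>s\<close> sits at \<open>s * p i\<close> for both signs \<open>s\<close>,
  so the total charge is zero. Equal signs give the difference terms and opposite signs the sum
  terms, each twice because the kernel is even.\<close>

lemma log_energy_antipodal_nonpos:
  fixes p :: "'a \<Rightarrow> complex"
  assumes "0 < \<epsilon>" "\<epsilon> \<le> 1"
  shows "(\<Sum>i\<in>I. \<Sum>j\<in>I. ln ((cmod (p i - p j))\<^sup>2 + \<epsilon>) - ln ((cmod (p i + p j))\<^sup>2 + \<epsilon>)) \<le> 0"
proof -
  define S where "S = {1, - 1 :: real}"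
  have S: "sum f S = f 1 + f (- 1)" for f :: "real \<Rightarrow> real" by (simp add: S_def)
  have P: "sum F (S \<times> I) = (\<Sum>i\<in>I. F (1, i) + F (- 1, i))" for F :: "real \<times> 'a \<Rightarrow> real"
  proof -
    have "sum F (S \<times> I) = (\<Sum>s\<in>S. \<Sum>i\<in>I. F (s, i))"
      by (simp add: sum.cartesian_product)
    then show ?thesis by (simp add: S sum.distrib)
  qed
  define L where "L z = ln ((cmod z)\<^sup>2 + \<epsilon>)" for z
  have L: "L (- z) = L z" for z by (simp add: L_def)
  have "(\<Sum>x\<in>S \<times> I. \<Sum>y\<in>S \<times> I. fst x * fst y *
      L (of_real (fst x) * p (snd x) - of_real (fst y) * p (snd y))) \<le> 0"
    unfolding L_def using assms by (rule log_energy_nonpos) (simp add: P)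
  also have "(\<Sum>x\<in>S \<times> I. \<Sum>y\<in>S \<times> I. fst x * fst y *
      L (of_real (fst x) * p (snd x) - of_real (fst y) * p (snd y)))
    = (\<Sum>i\<in>I. \<Sum>j\<in>I. L (p i - p j) - L (p i + p j) + (L (- (p i - p j)) - L (- (p i + p j))))"
    unfolding P sum.distrib[symmetric] by (intro sum.cong refl) simp
  also have "\<dots> = 2 * (\<Sum>i\<in>I. \<Sum>j\<in>I. L (p i - p j) - L (p i + p j))"
    unfolding L by (simp add: sum_distrib_left)
  finally show ?thesis by (simp add: L_def)
qed

subsection \<open>Means over roots of unity\<close>

abbreviation roots_unity :: "nat \<Rightarrow> complex set" where
  "roots_unity n \<equiv> {w. w ^ n = 1}"

text \<open>Multiplication by a primitive root permutes the roots and multiplies the sum by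
  \<open>\<omega> ^ k\<close>, which differs from 1.\<close>

lemma sum_power_roots_unity:
  assumes "0 < k" "k < n"
  shows "(\<Sum>w\<in>roots_unity n. w ^ k) = (0 :: complex)"
proof -
  let ?U = "roots_unity n"
  have n: "n > 0" using assms by simp
  define \<omega> where "\<omega> = cis (2 * pi / n)"
  have \<omega>: "\<omega> ^ n = 1" using n by (simp add: \<omega>_def Complex.DeMoivre)
  have "\<omega> \<noteq> 0" by (simp add: \<omega>_def)
  have "\<omega> ^ k \<noteq> 1"
  proof
    assume "\<omega> ^ k = 1"
    then have "cis (2 * pi * real k / real n) = cis (2 * pi * real 0 / real n)"
      by (simp add: \<omega>_def Complex.DeMoivre mult_ac)
    moreover have "inj_on (\<lambda>k. cis (2 * pi * real k / real n)) {..<n}"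
      using Complex.bij_betw_roots_unity[OF n] by (rule bij_betw_imp_inj_on)
    ultimately have "k = 0" using assms by (elim inj_onD) auto
    then show False using assms by simp
  qed
  have "bij_betw (\<lambda>w. \<omega> * w) ?U ?U"
    by (rule bij_betwI[where g = "\<lambda>w. w / \<omega>"])
       (use \<omega> \<open>\<omega> \<noteq> 0\<close> in \<open>auto simp: power_mult_distrib power_divide\<close>)
  then have "(\<Sum>w\<in>?U. w ^ k) = (\<Sum>w\<in>?U. (\<omega> * w) ^ k)"
    by (rule sum.reindex_bij_betw[symmetric])
  also have "\<dots> = \<omega> ^ k * (\<Sum>w\<in>?U. w ^ k)"
    by (simp add: power_mult_distrib sum_distrib_left)
  finally show ?thesis using \<open>\<omega> ^ k \<noteq> 1\<close> by (simp add: mult_cancel_right1)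
qed

text \<open>Both sides are the derivative at \<open>v\<close> of the polynomial
  \<open>x ^ n - 1\<close>, once from its linear factors and once from its monomial form. Its
  modulus \<open>n\<close> gives the logarithmic interaction of one root with all the
  others.\<close>

lemma prod_diff_roots_unity:
  fixes v :: complex
  assumes "n > 0" "v ^ n = 1"
  shows "(\<Prod>w\<in>roots_unity n - {v}. v - w) = of_nat n * v ^ (n - 1)"
proof -
  let ?U = "roots_unity n"
  have U: "finite ?U" "card ?U = n" using assms by (auto intro: finite_roots_unity card_roots_unity_eq)
  define p where "p = monom 1 n - (1 :: complex poly)"
  define q where "q = (\<Prod>w\<in>?U. [:- w, 1:])"
  have q: "degree q = n" "lead_coeff q = 1"
    using U lead_coeff_prod[of "\<lambda>w. [:- w, 1:]" ?U] unfolding q_def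
    by (simp_all add: degree_prod_eq_sum_degree)
  have p: "degree p = n" "lead_coeff p = 1"
  proof -
    show "degree p = n"
      using assms(1) degree_add_eq_left[of "- 1" "monom (1::complex) n"]
      unfolding p_def by (simp add: degree_monom_eq)
    then show "lead_coeff p = 1" using assms(1) by (simp add: p_def)
  qed
  have "p = q"
  \<comment> \<open>Two monic polynomials of degree \<open>n\<close> differ by one of degree below
    \<open>n\<close>, which cannot have the \<open>n\<close> common roots unless it is zero.\<close>
  proof (rule ccontr)
    assume "p \<noteq> q"
    then have nz: "p - q \<noteq> 0" by simp
    have "degree (p - q) < n"
    proof (rule ccontr)
      assume "\<not> degree (p - q) < n"
      with degree_diff_le[of p n q] p q have "degree (p - q) = n" by simp
      then have "lead_coeff (p - q) = 0" using p q by simp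
      with nz show False using leading_coeff_neq_0 by blast
    qed
    moreover have "card ?U \<le> card {x. poly (p - q) x = 0}"
      by (intro card_mono poly_roots_finite nz)
         (use U in \<open>auto simp: p_def q_def poly_monom poly_prod\<close>)
    ultimately show False using card_poly_roots_bound[OF nz] U by linarith
  qed
  then have "poly (pderiv p) v = poly (pderiv q) v" by simp
  moreover have "poly (pderiv p) v = of_nat n * v ^ (n - 1)"
    by (simp add: p_def pderiv_diff pderiv_monom poly_monom)
  moreover have "poly (pderiv q) v = (\<Sum>a\<in>?U. \<Prod>w\<in>?U - {a}. v - w)"
    by (simp add: q_def pderiv_prod poly_sum poly_prod pderiv_pCons)
  \<comment> \<open>For \<open>a \<noteq> v\<close> the product still contains the factor
    \<open>v - v\<close>.\<close>
  moreover have "\<dots> = (\<Sum>a\<in>{v}. \<Prod>w\<in>?U - {a}. v - w)"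
    using U assms by (intro sum.mono_neutral_right) auto
  ultimately show ?thesis by simp
qed

text \<open>Averaging kills the Taylor terms of degree strictly between 0 and \<open>n\<close>;
  Cauchy's estimates at radius \<open>R\<close> bound the rest by a geometric tail. The error is
  explicit so that it can be used uniformly over a family of functions.\<close>

lemma mean_roots_unity:
  fixes f :: "complex \<Rightarrow> complex"
  assumes f: "f holomorphic_on ball 0 \<rho>" and "0 < r" "r < R" "R < \<rho>"
    and B: "\<And>z. cmod z = R \<Longrightarrow> cmod (f z - f 0) \<le> B" and n: "n > 0"
  shows "cmod ((\<Sum>w\<in>roots_unity n. f (r * w)) / n - f 0) \<le> B / (1 - r / R) * (r / R) ^ n"
proof -
  let ?U = "roots_unity n"
  have U: "finite ?U" "card ?U = n" using n by (auto intro: finite_roots_unity card_roots_unity_eq)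
  have norm: "cmod w = 1" if "w \<in> ?U" for w
    using that n power_eq_1_iff[of w n] by auto
  define q where "q = r / R"
  have q: "0 < q" "q < 1" using assms by (auto simp: q_def)
  define g where "g z = f z - f 0" for z
  define a where "a k = (deriv ^^ k) g 0 / fact k" for k
  have g: "g holomorphic_on ball 0 \<rho>" unfolding g_def using f by (intro holomorphic_intros)
  have a: "cmod (a k) \<le> B / R ^ k" for k
  proof -
    have "cmod ((deriv ^^ k) g 0) \<le> fact k * B / R ^ k"
    proof (rule Cauchy_inequality)
      show "g holomorphic_on ball 0 R" by (rule holomorphic_on_subset[OF g]) (use assms in auto)
      show "continuous_on (cball 0 R) g"
        by (rule holomorphic_on_imp_continuous_on, rule holomorphic_on_subset[OF g]) (use assms in auto)
    qed (use assms in \<open>auto simp: g_def\<close>)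
    then show ?thesis by (simp add: a_def norm_divide field_simps)
  qed
  have a0: "a 0 = 0" by (simp add: a_def g_def)
  have "(\<lambda>k. a k * (r * w) ^ k) sums g (r * w)" if "w \<in> ?U" for w :: complex
  proof -
    have "complex_of_real r * w \<in> ball 0 \<rho>" using assms norm[OF that] by (simp add: norm_mult)
    from holomorphic_power_series[OF g this] show ?thesis by (simp add: a_def)
  qed
  then have S: "(\<lambda>k. (\<Sum>w\<in>?U. a k * (r * w) ^ k) / n) sums ((\<Sum>w\<in>?U. g (r * w)) / n)"
    by (intro sums_divide sums_sum) simp
  have T: "cmod ((\<Sum>w\<in>?U. a k * (r * w) ^ k) / n) \<le> (if k < n then 0 else B * q ^ k)" for k
  proof (cases "k < n")
    case True
    have "(\<Sum>w\<in>?U. a k * (r * w) ^ k) = a k * r ^ k * (\<Sum>w\<in>?U. w ^ k)"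
      by (simp add: sum_distrib_left power_mult_distrib mult_ac)
    also have "\<dots> = 0"
      using True sum_power_roots_unity[of k n] a0 by (cases "k = 0") auto
    finally show ?thesis using True by simp
  next
    case False
    have "cmod (\<Sum>w\<in>?U. a k * (r * w) ^ k) \<le> (\<Sum>w\<in>?U. B * q ^ k)"
    proof (rule sum_norm_le)
      fix w assume "w \<in> ?U"
      have "cmod (a k * (r * w) ^ k) = cmod (a k) * r ^ k"
        using norm[OF \<open>w \<in> ?U\<close>] assms by (simp add: norm_mult norm_power)
      also have "\<dots> \<le> B / R ^ k * r ^ k" using a assms by (intro mult_right_mono) auto
      finally show "cmod (a k * (r * w) ^ k) \<le> B * q ^ k" by (simp add: q_def power_divide)
    qed
    then show ?thesis using U n False by (simp add: norm_divide field_simps)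
  qed
  have "(\<lambda>k. if k < n then 0 else B * q ^ k) sums (B * q ^ n / (1 - q))"
  proof -
    have "(\<lambda>k. B * q ^ n * q ^ k) sums (B * q ^ n * (1 / (1 - q)))"
      using q by (intro sums_mult geometric_sums) auto
    then have "(\<lambda>k. if k + n < n then 0 else B * q ^ (k + n)) sums (B * q ^ n / (1 - q))"
      by (simp add: power_add mult_ac)
    then show ?thesis by (subst (asm) sums_zero_iff_shift) auto
  qed
  then have "cmod ((\<Sum>w\<in>?U. g (r * w)) / n) \<le> B * q ^ n / (1 - q)"
    using S T by (metis (no_types, lifting) norm_suminf_le sums_unique sums_summable)
  moreover have "(\<Sum>w\<in>?U. g (r * w)) / n = (\<Sum>w\<in>?U. f (r * w)) / n - f 0"
    using U n by (simp add: g_def sum_subtractf diff_divide_distrib)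
  ultimately show ?thesis by (simp add: q_def)
qed

text \<open>\<open>ln (cmod (G z))\<close> is the real part of a holomorphic logarithm
  \<open>g\<close>. Bounding \<open>g' = G' / G\<close> controls the oscillation of \<open>g\<close>
  independently of the branch, so the error depends only on \<open>K\<close>, \<open>n\<close> and
  the radii.\<close>

lemma ln_norm_mean_roots_unity:
  fixes G :: "complex \<Rightarrow> complex"
  assumes G: "G holomorphic_on ball 0 \<rho>" and nz: "\<And>z. z \<in> ball 0 \<rho> \<Longrightarrow> G z \<noteq> 0"
    and "0 < r" "r < R'" "R' < R" "R < \<rho>"
    and ub: "\<And>z. cmod z \<le> R \<Longrightarrow> cmod (G z) \<le> K" and lb: "\<And>z. cmod z \<le> R \<Longrightarrow> 1 \<le> K * cmod (G z)"
    and n: "n > 0"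
  shows "\<bar>(\<Sum>w\<in>roots_unity n. ln (cmod (G (r * w)))) / n - ln (cmod (G 0))\<bar>
     \<le> K\<^sup>2 * R' / (R - R') / (1 - r / R') * (r / R') ^ n"
proof -
  let ?U = "roots_unity n"
  have norm: "cmod w = 1" if "w \<in> ?U" for w
    using that n power_eq_1_iff[of w n] by auto
  have "K \<ge> 0" using order_trans[OF norm_ge_zero ub[of 0]] assms by auto
  obtain g where g: "g holomorphic_on ball 0 \<rho>" and exp: "\<And>z. z \<in> ball 0 \<rho> \<Longrightarrow> exp (g z) = G z"
    using holomorphic_logarithm_exists[OF convex_ball open_ball G nz, of 0] assms by auto
  have Re: "ln (cmod (G z)) = Re (g z)" if "z \<in> ball 0 \<rho>" for z
    using exp[OF that] by (metis ln_exp norm_exp_eq_Re)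
  \<comment> \<open>The gap \<open>R - R'\<close> is the room for Cauchy's estimate, while
    \<open>R'\<close> is the circle on which \<open>mean_roots_unity\<close> needs its
    bound.\<close>
  have dG: "cmod (deriv G z) \<le> K / (R - R')" if "cmod z \<le> R'" for z
  proof -
    have sub: "cball z (R - R') \<subseteq> cball 0 R"
      using that by (subst cball_subset_cball_iff) (auto simp: assms dist_norm)
    have "cmod ((deriv ^^ 1) G z) \<le> fact 1 * K / (R - R') ^ 1"
    proof (rule Cauchy_inequality)
      show "G holomorphic_on ball z (R - R')"
        by (rule holomorphic_on_subset[OF G]) (use sub ball_subset_cball assms in fastforce)
      show "continuous_on (cball z (R - R')) G"
        by (rule holomorphic_on_imp_continuous_on, rule holomorphic_on_subset[OF G])
           (use sub assms in fastforce)
      show "cmod (G x) \<le> K" if "cmod (z - x) = R - R'" for x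
        using sub that by (intro ub) (auto simp: dist_norm subset_iff)
    qed (use assms in auto)
    then show ?thesis by simp
  qed
  have dg: "cmod (deriv g z) \<le> K\<^sup>2 / (R - R')" if "cmod z \<le> R'" for z
  proof -
    have z: "z \<in> ball 0 \<rho>" using that assms by auto
    have "(g has_field_derivative deriv g z) (at z)"
      by (rule holomorphic_derivI[OF g open_ball z])
    then have "((\<lambda>z. exp (g z)) has_field_derivative exp (g z) * deriv g z) (at z)"
      by (auto intro!: derivative_eq_intros)
    then have "(G has_field_derivative exp (g z) * deriv g z) (at z)"
      by (rule DERIV_cong_ev[OF refl _ refl, THEN iffD1, rotated])
         (use z exp eventually_nhds_in_open[OF open_ball z] in \<open>auto elim!: eventually_mono\<close>)
    then have "deriv G z = G z * deriv g z" using exp[OF z] by (simp add: DERIV_imp_deriv)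
    then have "cmod (deriv g z) * (K * cmod (G z)) = K * cmod (deriv G z)"
      by (simp only: norm_mult mult_ac)
    moreover have "cmod (deriv g z) * 1 \<le> cmod (deriv g z) * (K * cmod (G z))"
      using that assms by (intro mult_left_mono lb) auto
    moreover have "K * cmod (deriv G z) \<le> K * (K / (R - R'))"
      using dG[OF that] \<open>K \<ge> 0\<close> by (rule mult_left_mono)
    ultimately show ?thesis unfolding power2_eq_square times_divide_eq_right[symmetric] mult.assoc mult_1_right
      by linarith
  qed
  have "cmod (g z - g 0) \<le> K\<^sup>2 * R' / (R - R')" if "cmod z = R'" for z
  proof -
    have "cmod (g z - g 0) \<le> K\<^sup>2 / (R - R') * cmod (z - 0)"
    proof (rule field_differentiable_bound[where S = "cball 0 R'" and f' = "deriv g"])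
      show "convex (cball 0 R' :: complex set)" by simp
      show "(g has_field_derivative deriv g u) (at u within cball 0 R')" if "u \<in> cball 0 R'" for u
        using that assms(3-6) by (auto intro: has_field_derivative_at_within[OF holomorphic_derivI[OF g open_ball]])
      show "cmod (deriv g u) \<le> K\<^sup>2 / (R - R')" if "u \<in> cball 0 R'" for u
        using that by (intro dg) simp
      show "z \<in> cball 0 R'" "0 \<in> cball 0 R'" using that assms(3,4) by auto
    qed
    then show ?thesis using that by simp
  qed
  from mean_roots_unity[OF g assms(3,4) _ this n] assms(5,6)
  have *: "cmod ((\<Sum>w\<in>?U. g (r * w)) / n - g 0) \<le> K\<^sup>2 * R' / (R - R') / (1 - r / R') * (r / R') ^ n"
    by simp
  have "(\<Sum>w\<in>?U. ln (cmod (G (r * w)))) = Re (\<Sum>w\<in>?U. g (r * w))"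
    unfolding Re_sum using norm assms(3-6) by (intro sum.cong Re refl) (auto simp: norm_mult)
  then have "(\<Sum>w\<in>?U. ln (cmod (G (r * w)))) / n - ln (cmod (G 0)) = Re ((\<Sum>w\<in>?U. g (r * w)) / n - g 0)"
    using assms(3-6) Re[of 0] by simp
  then show ?thesis using order_trans[OF abs_Re_le_cmod *] by simp
qed

subsection \<open>The Koebe quarter theorem\<close>

lemma compact_norm_bounds:
  fixes f :: "'a :: topological_space \<Rightarrow> complex"
  assumes S: "compact S" and f: "continuous_on S f" and nz: "\<And>x. x \<in> S \<Longrightarrow> f x \<noteq> 0"
  shows "\<exists>K. \<forall>x\<in>S. cmod (f x) \<le> K \<and> 1 \<le> K * cmod (f x)"
proof -
  obtain K1 where K1: "\<And>x. x \<in> S \<Longrightarrow> cmod (f x) \<le> K1"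
    using compact_imp_bounded[OF compact_continuous_image[OF f S]] by (auto simp: bounded_iff)
  have "continuous_on S (\<lambda>x. inverse (f x))" using f nz by (intro continuous_intros) auto
  then obtain K2 where K2: "\<And>x. x \<in> S \<Longrightarrow> cmod (inverse (f x)) \<le> K2"
    using compact_imp_bounded[OF compact_continuous_image[OF _ S]] by (fastforce simp: bounded_iff)
  show ?thesis
  proof (intro exI[of _ "max K1 K2"] ballI conjI)
    fix x assume x: "x \<in> S"
    show "cmod (f x) \<le> max K1 K2" using K1[OF x] by simp
    have "1 = cmod (inverse (f x)) * cmod (f x)" using nz[OF x] by (simp flip: norm_mult)
    also have "\<dots> \<le> max K1 K2 * cmod (f x)"
      using K2[OF x] by (intro mult_right_mono) auto
    finally show "1 \<le> max K1 K2 * cmod (f x)" .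
  qed
qed

section \<open>The quotient \<open>(h z - h \<zeta>) / (h z + h \<zeta>)\<close> with its diagonal
  zero removed\<close>

text \<open>The diagonal value is the limit of the difference quotient, and at the centre it is
  \<open>deriv h 0 / (2 * h 0)\<close>, the quantity to be bounded by 1 in modulus.\<close>

definition dq :: "(complex \<Rightarrow> complex) \<Rightarrow> complex \<Rightarrow> complex \<Rightarrow> complex" where
  "dq h \<zeta> z = (if z = \<zeta> then deriv h \<zeta> else (h z - h \<zeta>) / (z - \<zeta>)) / (h z + h \<zeta>)"

lemma dq_commute: "dq h \<zeta> z = dq h z \<zeta>"
proof -
  have "(h z - h \<zeta>) / (z - \<zeta>) = (h \<zeta> - h z) / (\<zeta> - z)"
    by (metis minus_diff_eq minus_divide_divide)
  then show ?thesis by (simp add: dq_def add.commute)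
qed

context
  fixes h :: "complex \<Rightarrow> complex"
  assumes h: "h holomorphic_on ball 0 1" and inj: "inj_on h (ball 0 1)"
    and disj: "\<And>z w. z \<in> ball 0 1 \<Longrightarrow> w \<in> ball 0 1 \<Longrightarrow> h z + h w \<noteq> 0"
begin

lemma dq_holomorphic:
  assumes "\<zeta> \<in> ball 0 1"
  shows "dq h \<zeta> holomorphic_on ball 0 1"
  unfolding dq_def[abs_def]
  by (rule holomorphic_on_divide[OF pole_lemma_open[OF h open_ball]])
     (use assms disj in \<open>auto intro!: holomorphic_intros h\<close>)

text \<open>Off the diagonal this is injectivity of \<open>h\<close>; on it, an injective
  holomorphic map has nonzero derivative.\<close>

lemma dq_nonzero:
  assumes "\<zeta> \<in> ball 0 1" "z \<in> ball 0 1"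
  shows "dq h \<zeta> z \<noteq> 0"
  using assms disj[of z \<zeta>] holomorphic_injective_imp_regular[OF h open_ball inj, of \<zeta>] inj_onD[OF inj, of z \<zeta>]
  by (auto simp: dq_def)

text \<open>Joint continuity across the diagonal is avoided: with \<open>z\<close> on a larger
  circle and \<open>\<zeta>\<close> in the smaller disc the two never meet. Maximum modulus in
  \<open>z\<close>, for \<open>dq h \<zeta>\<close> and its inverse, carries the bounds
  inwards.\<close>

lemma dq_bounds:
  assumes "0 < R" "R < 1"
  shows "\<exists>K. \<forall>z\<in>cball 0 R. \<forall>\<zeta>\<in>cball 0 R. cmod (dq h \<zeta> z) \<le> K \<and> 1 \<le> K * cmod (dq h \<zeta> z)"
proof -
  obtain R' where R': "R < R'" "R' < 1" using assms dense by blast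
  define S where "S = (sphere 0 R' :: complex set) \<times> (cball 0 R :: complex set)"
  have S: "fst x \<in> ball 0 1" "snd x \<in> ball 0 1" "fst x \<noteq> snd x" if "x \<in> S" for x :: "complex \<times> complex"
    using that R' assms by (auto simp: S_def)
  have hc: "continuous_on (ball 0 1) h" using h by (rule holomorphic_on_imp_continuous_on)
  have "compact S" by (simp add: S_def compact_Times)
  moreover have "continuous_on S (\<lambda>x. (h (fst x) - h (snd x)) / (fst x - snd x) / (h (fst x) + h (snd x)))"
    using S disj by (intro continuous_intros continuous_on_compose2[OF hc]) auto
  then have "continuous_on S (\<lambda>x. dq h (snd x) (fst x))"
    by (rule continuous_on_eq) (use S in \<open>auto simp: dq_def\<close>)
  moreover have "dq h (snd x) (fst x) \<noteq> 0" if "x \<in> S" for x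
    using dq_nonzero S[OF that] by blast
  ultimately obtain K where K: "\<forall>x\<in>S. cmod (dq h (snd x) (fst x)) \<le> K \<and> 1 \<le> K * cmod (dq h (snd x) (fst x))"
    using compact_norm_bounds[of S "\<lambda>x. dq h (snd x) (fst x)"] by blast
  have sub: "cball 0 R' \<subseteq> (ball 0 1 :: complex set)" using R' by auto
  have "cmod (dq h \<zeta> z) \<le> K \<and> 1 \<le> K * cmod (dq h \<zeta> z)" if "z \<in> cball 0 R" "\<zeta> \<in> cball 0 R" for z \<zeta>
  proof -
    have mem: "z \<in> cball 0 R'" "\<zeta> \<in> ball 0 1" "z \<in> ball 0 1" using that R' by auto
    have K': "cmod (dq h \<zeta> u) \<le> K" "1 \<le> K * cmod (dq h \<zeta> u)" if "u \<in> sphere 0 R'" for u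
      using K \<open>\<zeta> \<in> cball 0 R\<close> that by (auto simp: S_def)
    have hol: "dq h \<zeta> holomorphic_on cball 0 R'"
      using dq_holomorphic[OF mem(2)] sub by (rule holomorphic_on_subset)
    have hol': "(\<lambda>u. inverse (dq h \<zeta> u)) holomorphic_on cball 0 R'"
      using hol dq_nonzero[OF mem(2)] sub by (intro holomorphic_on_inverse) auto
    have 1: "cmod (dq h \<zeta> z) \<le> K"
      by (rule maximum_modulus_frontier[of "dq h \<zeta>" "cball 0 R'"])
         (use hol mem K' R' assms in
           \<open>auto intro: holomorphic_on_subset holomorphic_on_imp_continuous_on simp: frontier_cball\<close>)
    have "cmod (inverse (dq h \<zeta> z)) \<le> K"
    proof (rule maximum_modulus_frontier[of "\<lambda>u. inverse (dq h \<zeta> u)" "cball 0 R'"])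
      show "cmod (inverse (dq h \<zeta> u)) \<le> K" if "u \<in> frontier (cball 0 R')" for u
      proof -
        have u: "u \<in> sphere 0 R'" using that by (simp add: frontier_cball)
        then have "dq h \<zeta> u \<noteq> 0" using dq_nonzero[OF mem(2)] R' by auto
        then show ?thesis
          using K'(2)[OF u] unfolding norm_inverse by (simp add: inverse_eq_divide pos_divide_le_eq)
      qed
    qed (use hol' mem in \<open>auto intro: holomorphic_on_subset holomorphic_on_imp_continuous_on\<close>)
    then have "1 \<le> K * cmod (dq h \<zeta> z)"
      using dq_nonzero[OF mem(2,3)] unfolding norm_inverse by (simp add: inverse_eq_divide pos_divide_le_eq)
    with 1 show ?thesis by simp
  qed
  then show ?thesis by blast
qed

text \<open>The one-variable mean is applied first in \<open>w\<close> for each \<open>v\<close>,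
  then in \<open>v\<close> at the centre \<open>w = 0\<close>, where symmetry of \<open>dq\<close>
  exchanges the variables. Each application costs \<open>C * q ^ n\<close>, with \<open>C\<close>
  uniform in the fixed variable.\<close>

lemma ln_dq_double_mean:
  fixes r :: real
  assumes "0 < r" "r < 1"
  shows "\<exists>C q. 0 < q \<and> q < 1 \<and> (\<forall>n>0. real n * (real n * (ln (cmod (dq h 0 0)) - C * q ^ n))
     \<le> (\<Sum>v\<in>roots_unity n. \<Sum>w\<in>roots_unity n. ln (cmod (dq h (r * v) (r * w)))))"
proof -
  obtain R where R: "r < R" "R < 1" using assms dense by blast
  obtain R' where R': "r < R'" "R' < R" using R dense by blast
  obtain K where K: "\<And>z \<zeta>. z \<in> cball 0 R \<Longrightarrow> \<zeta> \<in> cball 0 R \<Longrightarrow> cmod (dq h \<zeta> z) \<le> K"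
      "\<And>z \<zeta>. z \<in> cball 0 R \<Longrightarrow> \<zeta> \<in> cball 0 R \<Longrightarrow> 1 \<le> K * cmod (dq h \<zeta> z)"
    using dq_bounds[of R] assms R by force
  define C where "C = K\<^sup>2 * R' / (R - R') / (1 - r / R')"
  define q where "q = r / R'"
  have q: "0 < q" "q < 1" using assms R' by (auto simp: q_def)
  have mean: "real n * (ln (cmod (dq h \<zeta> 0)) - C * q ^ n) \<le> (\<Sum>w\<in>roots_unity n. ln (cmod (dq h \<zeta> (r * w))))"
    if "n > 0" "\<zeta> \<in> cball 0 R" for n \<zeta>
  proof -
    have z: "\<zeta> \<in> ball 0 1" using that R by auto
    have "\<bar>(\<Sum>w\<in>roots_unity n. ln (cmod (dq h \<zeta> (r * w)))) / n - ln (cmod (dq h \<zeta> 0))\<bar> \<le> C * q ^ n"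
      unfolding C_def q_def
      by (rule ln_norm_mean_roots_unity[OF dq_holomorphic[OF z] dq_nonzero[OF z]])
         (use assms R R' K that in auto)
    then have "ln (cmod (dq h \<zeta> 0)) - C * q ^ n \<le> (\<Sum>w\<in>roots_unity n. ln (cmod (dq h \<zeta> (r * w)))) / n"
      by linarith
    then show ?thesis using that by (simp add: field_simps)
  qed
  have "real n * (real n * (ln (cmod (dq h 0 0)) - 2 * C * q ^ n))
     \<le> (\<Sum>v\<in>roots_unity n. \<Sum>w\<in>roots_unity n. ln (cmod (dq h (r * v) (r * w))))" if n: "n > 0" for n
  proof -
    let ?U = "roots_unity n"
    have U: "finite ?U" "card ?U = n" using n by (auto intro: finite_roots_unity card_roots_unity_eq)
    have norm: "cmod w = 1" if "w \<in> ?U" for w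
      using that n power_eq_1_iff[of w n] by auto
    have "real n * (ln (cmod (dq h 0 0)) - C * q ^ n) \<le> (\<Sum>v\<in>?U. ln (cmod (dq h 0 (r * v))))"
      using assms R n by (intro mean) auto
    then have "real n * (real n * (ln (cmod (dq h 0 0)) - C * q ^ n)) \<le> real n * (\<Sum>v\<in>?U. ln (cmod (dq h 0 (r * v))))"
      by (rule mult_left_mono) simp
    then have "real n * (real n * (ln (cmod (dq h 0 0)) - 2 * C * q ^ n))
       \<le> real n * (\<Sum>v\<in>?U. ln (cmod (dq h 0 (r * v)))) - real n * (real n * (C * q ^ n))"
      by (simp add: algebra_simps)
    also have "\<dots> = (\<Sum>v\<in>?U. real n * (ln (cmod (dq h (r * v) 0)) - C * q ^ n))"
      by (simp add: sum_distrib_left sum_subtractf right_diff_distrib U dq_commute[of h 0])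
    also have "\<dots> \<le> (\<Sum>v\<in>?U. \<Sum>w\<in>?U. ln (cmod (dq h (r * v) (r * w))))"
      using assms R norm n by (intro sum_mono mean) (auto simp: norm_mult)
    finally show ?thesis .
  qed
  then show ?thesis using q by (intro exI[of _ "2 * C"] exI[of _ q]) auto
qed

text \<open>Dropping \<epsilon> from the first logarithm only lowers it; dropping it from the second
  costs at most \<open>\<epsilon> / b \<le> \<epsilon> * K\<^sup>2\<close>. What remains factors
  through \<open>dq\<close> and \<open>z - w\<close>.\<close>

lemma energy_term_ge:
  assumes z: "z \<in> ball 0 1" and w: "w \<in> ball 0 1" and "z \<noteq> w" "0 < \<epsilon>" and K: "1 \<le> K * cmod (h z + h w)"
  shows "2 * ln (cmod (dq h z w)) + 2 * ln (cmod (z - w)) - \<epsilon> * K\<^sup>2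
    \<le> ln ((cmod (h z - h w))\<^sup>2 + \<epsilon>) - ln ((cmod (h z + h w))\<^sup>2 + \<epsilon>)"
proof -
  define a where "a = (cmod (h z - h w))\<^sup>2"
  define b where "b = (cmod (h z + h w))\<^sup>2"
  have "h z \<noteq> h w" using inj_onD[OF inj] assms by blast
  then have a: "a > 0" by (simp add: a_def)
  have b: "b > 0" using disj[OF z w] by (simp add: b_def)
  have "cmod (dq h z w) * cmod (z - w) * cmod (h z + h w) = cmod (h z - h w)"
    using assms(3) disj[OF z w] by (simp add: dq_def norm_divide norm_mult norm_minus_commute add.commute)
  then have "a = (cmod (dq h z w))\<^sup>2 * (cmod (z - w))\<^sup>2 * b"
    unfolding a_def b_def by (metis power_mult_distrib)
  then have "ln a = 2 * ln (cmod (dq h z w)) + 2 * ln (cmod (z - w)) + ln b"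
    using b assms dq_nonzero[OF z w] by (simp add: ln_mult ln_realpow)
  moreover have "ln a \<le> ln (a + \<epsilon>)" using a assms by simp
  moreover have "ln (b + \<epsilon>) \<le> ln b + \<epsilon> * K\<^sup>2"
  proof -
    have "1 + \<epsilon> / b = (b + \<epsilon>) / b" using b by (simp add: field_simps)
    then have "ln (b + \<epsilon>) - ln b = ln (1 + \<epsilon> / b)"
      using b \<open>0 < \<epsilon>\<close> by (simp add: ln_div)
    also have "\<dots> \<le> \<epsilon> / b" using b assms by (intro ln_add_one_self_le_self) auto
    also have "\<dots> \<le> \<epsilon> * K\<^sup>2"
    proof -
      have "1 \<le> (K * cmod (h z + h w))\<^sup>2" using K by (simp add: one_le_power)
      then have "\<epsilon> * 1 \<le> \<epsilon> * (K\<^sup>2 * b)"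
        using assms unfolding b_def power_mult_distrib by (intro mult_left_mono) auto
      then show ?thesis using b by (simp add: field_simps)
    qed
    finally show ?thesis by simp
  qed
  ultimately show ?thesis by (simp add: a_def b_def)
qed

text \<open>The nonpositive antipodal energy of the points \<open>h (r * v)\<close> is bounded below
  row by row. Inserting the double mean and dividing by \<open>2 * n\<^sup>2\<close> leaves errors
  that vanish as \<open>n\<close> grows with \<open>r\<close> fixed.\<close>

lemma ln_dq_le:
  assumes "0 < r" "r < 1"
  shows "ln (cmod (dq h 0 0)) + ln r \<le> 0"
proof -
  obtain C q where q: "0 < q" "q < 1" and mean: "\<And>n. n > 0 \<Longrightarrow>
      real n * (real n * (ln (cmod (dq h 0 0)) - C * q ^ n))
     \<le> (\<Sum>v\<in>roots_unity n. \<Sum>w\<in>roots_unity n. ln (cmod (dq h (r * v) (r * w))))"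
    using ln_dq_double_mean[OF assms] by blast
  obtain K where K: "\<And>z \<zeta>. z \<in> cball 0 r \<Longrightarrow> \<zeta> \<in> cball 0 r \<Longrightarrow> cmod (dq h \<zeta> z) \<le> K"
    using dq_bounds[OF assms] by blast
  have sub: "cball 0 r \<subseteq> (ball 0 1 :: complex set)" using assms by auto
  have hc: "continuous_on (cball 0 r) h"
    using h sub holomorphic_on_imp_continuous_on holomorphic_on_subset by blast
  have "continuous_on (cball 0 r \<times> cball 0 r) (\<lambda>x. h (fst x) + h (snd x))"
    by (intro continuous_intros continuous_on_compose2[OF hc]) auto
  moreover have "compact (cball (0 :: complex) r \<times> cball (0 :: complex) r)"
    by (simp add: compact_Times)
  moreover have "h (fst x) + h (snd x) \<noteq> 0" if "x \<in> cball 0 r \<times> cball 0 r" for x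
    using that sub by (intro disj) auto
  ultimately obtain H where "\<forall>x\<in>cball 0 r \<times> cball 0 r. cmod (h (fst x) + h (snd x)) \<le> H
      \<and> 1 \<le> H * cmod (h (fst x) + h (snd x))"
    using compact_norm_bounds[of "cball 0 r \<times> cball 0 r" "\<lambda>x. h (fst x) + h (snd x)"] by blast
  then have H: "cmod (h z + h w) \<le> H" "1 \<le> H * cmod (h z + h w)"
    if "z \<in> cball 0 r" "w \<in> cball 0 r" for z w
    using that by auto
  \<comment> \<open>The summands pay for the off-diagonal \<epsilon>-errors of a row, the sum term
    \<open>h (r * v) + h (r * v)\<close> on the diagonal, and the diagonal value of
    \<open>l\<close>, which the energy lacks but the full double mean includes.\<close>
  define A where "A = H\<^sup>2 + ln (H\<^sup>2 + 1) + 2 * ln K"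
  have main: "ln (cmod (dq h 0 0)) + ln r \<le> C * q ^ n + A / 2 * (1 / real n)" if n: "n > 0" for n
  proof -
    let ?U = "roots_unity n"
    have U: "finite ?U" "card ?U = n" using n by (auto intro: finite_roots_unity card_roots_unity_eq)
    have norm: "cmod w = 1" if "w \<in> ?U" for w
      using that n power_eq_1_iff[of w n] by auto
    have mem: "r * w \<in> cball 0 r" "r * w \<in> ball 0 1" if "w \<in> ?U" for w :: complex
      using norm[OF that] assms by (auto simp: norm_mult)
    \<comment> \<open>With this \<open>\<epsilon>\<close> the diagonal contributes only \<open>- ln n\<close> per row (absorbed by
      \<open>2 ln (\<Prod>w\<noteq>v. |v - w|) = 2 ln n\<close>), and the off-diagonal error per row stays bounded.\<close>
    define \<epsilon> where "\<epsilon> = 1 / real n"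
    have \<epsilon>: "0 < \<epsilon>" "\<epsilon> \<le> 1" using n by (auto simp: \<epsilon>_def)
    define E where "E v w = ln ((cmod (h (r * v) - h (r * w)))\<^sup>2 + \<epsilon>)
      - ln ((cmod (h (r * v) + h (r * w)))\<^sup>2 + \<epsilon>)" for v w :: complex
    define l where "l v w = ln (cmod (dq h (r * v) (r * w)))" for v w :: complex
    have row: "2 * (\<Sum>w\<in>?U. l v w) + 2 * (real n * ln r) - A \<le> (\<Sum>w\<in>?U. E v w)" if v: "v \<in> ?U" for v
    proof -
      have card: "real (card (?U - {v})) = real n - 1" using U v n by (simp add: of_nat_diff)
      have pos: "cmod (v - w) > 0" if "w \<in> ?U - {v}" for w using that by auto
      have "(\<Sum>w\<in>?U - {v}. ln (cmod (v - w))) = ln (cmod (\<Prod>w\<in>?U - {v}. v - w))"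
        unfolding prod_norm[symmetric] using U pos by (subst ln_prod) auto
      also have "\<dots> = ln n"
        using prod_diff_roots_unity[of n v] v n norm[OF v] by (simp add: norm_mult norm_power)
      finally have prod: "(\<Sum>w\<in>?U - {v}. ln (cmod (v - w))) = ln n" .
      have "(\<Sum>w\<in>?U - {v}. 2 * l v w + 2 * (ln r + ln (cmod (v - w))) - \<epsilon> * H\<^sup>2) \<le> (\<Sum>w\<in>?U - {v}. E v w)"
      proof (rule sum_mono)
        fix w assume w: "w \<in> ?U - {v}"
        have "cmod (r * v - r * w) = r * cmod (v - w)"
          using assms by (simp flip: right_diff_distrib add: norm_mult)
        then have eq: "ln (cmod (r * v - r * w)) = ln r + ln (cmod (v - w))"
          using pos[OF w] assms by (simp add: ln_mult)
        show "2 * l v w + 2 * (ln r + ln (cmod (v - w))) - \<epsilon> * H\<^sup>2 \<le> E v w"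
          unfolding l_def E_def eq[symmetric]
          using w v assms(1) by (intro energy_term_ge mem H(2) \<epsilon>(1)) auto
      qed
      moreover have "- ln n - ln (H\<^sup>2 + 1) \<le> E v v"
      proof -
        have "(cmod (h (r * v) + h (r * v)))\<^sup>2 \<le> H\<^sup>2"
          using mem(1)[OF v] by (intro power_mono H(1)) auto
        then have "ln ((cmod (h (r * v) + h (r * v)))\<^sup>2 + \<epsilon>) \<le> ln (H\<^sup>2 + 1)"
          using \<epsilon> by (subst ln_le_cancel_iff) (auto intro: add_nonneg_pos)
        then show ?thesis using n by (simp add: E_def \<epsilon>_def ln_div)
      qed
      moreover have "l v v \<le> ln K"
      proof -
        have "0 < cmod (dq h (r * v) (r * v))" using dq_nonzero mem[OF v] by simp
        then show ?thesis using K[OF mem(1)[OF v] mem(1)[OF v]] unfolding l_def by (simp add: ln_mono)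
      qed
      moreover have "(\<Sum>w\<in>?U. E v w) = E v v + (\<Sum>w\<in>?U - {v}. E v w)"
          "(\<Sum>w\<in>?U. l v w) = l v v + (\<Sum>w\<in>?U - {v}. l v w)"
        using U v by (auto intro: sum.remove)
      moreover have "(\<Sum>w\<in>?U - {v}. 2 * l v w + 2 * (ln r + ln (cmod (v - w))) - \<epsilon> * H\<^sup>2)
        = 2 * (\<Sum>w\<in>?U - {v}. l v w) + 2 * ((real n - 1) * ln r + ln n) - (real n - 1) * (\<epsilon> * H\<^sup>2)"
        unfolding prod[symmetric] card[symmetric]
        by (simp add: sum_subtractf sum.distrib sum_distrib_left)
      moreover have "(real n - 1) * (\<epsilon> * H\<^sup>2) \<le> H\<^sup>2"
      proof -
        have "(real n - 1) * \<epsilon> \<le> 1" using n by (simp add: \<epsilon>_def field_simps)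
        from mult_right_mono[OF this, of "H\<^sup>2"] show ?thesis by (simp add: mult.assoc)
      qed
      \<comment> \<open>Since \<open>ln r\<close> is negative, counting \<open>n\<close> instead of
        \<open>n - 1\<close> neighbours weakens the lower bound. One of the two copies of
        \<open>ln n\<close> survives the diagonal and is dropped as nonnegative.\<close>
      moreover have "real n * ln r \<le> (real n - 1) * ln r"
        using assms by (simp add: left_diff_distrib)
      moreover have "0 \<le> ln (real n)" using n by simp
      ultimately show ?thesis unfolding A_def by argo
    qed
    have "(\<Sum>v\<in>?U. 2 * (\<Sum>w\<in>?U. l v w) + 2 * (real n * ln r) - A) \<le> (\<Sum>v\<in>?U. \<Sum>w\<in>?U. E v w)"
      by (rule sum_mono[OF row])
    also have "\<dots> \<le> 0" unfolding E_def using \<epsilon> by (rule log_energy_antipodal_nonpos)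
    finally have "2 * (\<Sum>v\<in>?U. \<Sum>w\<in>?U. l v w) + n * (2 * (real n * ln r) - A) \<le> 0"
      by (simp add: sum.distrib sum_subtractf sum_distrib_left U algebra_simps)
    moreover have "n * (n * (ln (cmod (dq h 0 0)) - C * q ^ n)) \<le> (\<Sum>v\<in>?U. \<Sum>w\<in>?U. l v w)"
      unfolding l_def by (rule mean[OF n])
    ultimately have "2 * (n * (n * (ln (cmod (dq h 0 0)) - C * q ^ n))) + n * (2 * (real n * ln r) - A) \<le> 0"
      by linarith
    then have "n * (2 * real n * (ln (cmod (dq h 0 0)) - C * q ^ n) + (2 * (real n * ln r) - A)) \<le> 0"
      by (simp add: algebra_simps)
    then have "2 * real n * (ln (cmod (dq h 0 0)) - C * q ^ n) + (2 * (real n * ln r) - A) \<le> 0"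
      using n by (simp add: mult_le_0_iff)
    then show ?thesis using n by (simp add: field_simps)
  qed
  have "(\<lambda>n. C * q ^ n + A / 2 * (1 / real n)) \<longlonglongrightarrow> C * 0 + A / 2 * 0"
    using q by (intro tendsto_intros LIMSEQ_power_zero lim_1_over_n) auto
  then have "(\<lambda>n. C * q ^ n + A / 2 * (1 / real n)) \<longlonglongrightarrow> 0" by simp
  then show ?thesis
    by (rule LIMSEQ_le_const) (use main in \<open>auto intro!: exI[of _ 1]\<close>)
qed

text \<open>The radius \<open>r\<close> in \<open>ln_dq_le\<close> tends to 1, so the value of
  \<open>dq\<close> at the centre has modulus at most 1.\<close>

lemma deriv_le_of_antipodal_disjoint: "cmod (deriv h 0) \<le> 2 * cmod (h 0)"
proof -
  have h0: "h 0 \<noteq> 0" using disj[of 0 0] by auto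
  have pos: "cmod (dq h 0 0) > 0" using dq_nonzero[of 0 0] by simp
  have "cmod (dq h 0 0) \<le> 1"
  proof (rule field_le_mult_one_interval)
    fix r :: real assume r: "0 < r" "r < 1"
    have "ln (r * cmod (dq h 0 0)) \<le> 0"
      using ln_dq_le[OF r] pos r by (simp add: ln_mult)
    then show "r * cmod (dq h 0 0) \<le> 1" using pos r by simp
  qed
  moreover have "dq h 0 0 = deriv h 0 / (2 * h 0)" by (simp add: dq_def)
  ultimately show ?thesis using h0 by (simp add: norm_divide norm_mult field_simps)
qed

end

section \<open>From square roots to zero-free injections\<close>

text \<open>This is the quarter theorem for the omitted value 0. If the square root had
  \<open>h z = - h w\<close>, then \<open>g z = g w\<close>, hence \<open>z = w\<close> and
  \<open>h z = 0\<close>, contradicting that \<open>g\<close> is zero-free. The bound for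
  \<open>h\<close> is doubled by \<open>g' = 2 h h'\<close>.\<close>

lemma koebe_quarter_nonvanishing:
  assumes g: "g holomorphic_on ball 0 1" and inj: "inj_on g (ball 0 1)"
    and nz: "\<And>z. z \<in> ball 0 1 \<Longrightarrow> g z \<noteq> 0"
  shows "cmod (deriv g 0) \<le> 4 * cmod (g 0)"
proof -
  obtain h where h: "h holomorphic_on ball 0 1" and gh: "\<And>z. z \<in> ball 0 1 \<Longrightarrow> g z = h z ^ 2"
    using contractible_imp_holomorphic_sqrt[OF g convex_imp_contractible[OF convex_ball] nz] by auto
  have "inj_on h (ball 0 1)"
    using inj gh by (metis (no_types, lifting) inj_on_def)
  moreover have "h z + h w \<noteq> 0" if z: "z \<in> ball 0 1" and w: "w \<in> ball 0 1" for z w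
  proof
    assume *: "h z + h w = 0"
    then have "h z = - h w" by (simp add: add_eq_0_iff2)
    then have "g z = g w" using gh z w by simp
    then have "z = w" using inj_onD[OF inj] z w by blast
    with * gh[OF z] nz[OF z] show False by simp
  qed
  ultimately have le: "cmod (deriv h 0) \<le> 2 * cmod (h 0)"
    by (rule deriv_le_of_antipodal_disjoint[OF h])
  have "(h has_field_derivative deriv h 0) (at 0)"
    by (rule holomorphic_derivI[OF h open_ball]) simp
  then have "((\<lambda>z. h z ^ 2) has_field_derivative 2 * h 0 * deriv h 0) (at 0)"
    by (auto intro!: derivative_eq_intros)
  moreover have "eventually (\<lambda>z. h z ^ 2 = g z) (nhds 0)"
    using eventually_nhds_in_open[OF open_ball, of 0 0 1] gh by (auto elim!: eventually_mono)
  ultimately have "(g has_field_derivative 2 * h 0 * deriv h 0) (at 0)"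
    by (rule DERIV_cong_ev[OF refl _ refl, THEN iffD1, rotated])
  then have "cmod (deriv g 0) = 2 * cmod (h 0) * cmod (deriv h 0)"
    by (simp add: DERIV_imp_deriv norm_mult)
  also have "\<dots> \<le> 2 * cmod (h 0) * (2 * cmod (h 0))"
    using le by (intro mult_left_mono) auto
  also have "\<dots> = 4 * cmod (g 0)"
    by (simp add: gh norm_mult power2_eq_square)
  finally show ?thesis .
qed

text \<open>The inverse of \<open>f\<close>, restricted to the disc of radius \<open>r\<close> and
  translated by \<open>w\<close>, omits 0. Its rescaling has derivative \<open>r / f'(x)\<close> and
  value \<open>x - w\<close> at the centre.\<close>

lemma squeezing_disc_le:
  assumes "open D" "x \<in> D" and f: "f holomorphic_on D" "inj_on f D" "f x = 0"
    and r: "r > 0" "ball 0 r \<subseteq> f ` D" and w: "w \<notin> D"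
  shows "r \<le> 4 * cmod (x - w) * cmod (deriv f x)"
proof -
  obtain \<phi> where \<phi>: "\<phi> holomorphic_on f ` D" and d: "\<And>z. z \<in> D \<Longrightarrow> deriv f z * deriv \<phi> (f z) = 1"
      and inv: "\<And>z. z \<in> D \<Longrightarrow> \<phi> (f z) = z"
    using holomorphic_has_inverse[OF f(1) assms(1) f(2)] by blast
  define g where "g z = \<phi> (r * z) - w" for z :: complex
  have rz: "r * z \<in> f ` D" if "z \<in> ball 0 1" for z :: complex
    using that r by (intro subsetD[OF r(2)]) (auto simp: norm_mult)
  have op: "open (f ` D)" by (rule open_mapping_thm3[OF f(1) assms(1) f(2)])
  have "g holomorphic_on ball 0 1"
  proof -
    have "(\<phi> \<circ> (\<lambda>z. r * z)) holomorphic_on ball 0 1"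
      by (rule holomorphic_on_compose_gen[OF _ \<phi>]) (use rz in \<open>auto intro!: holomorphic_intros\<close>)
    then show ?thesis unfolding g_def comp_def by (intro holomorphic_intros)
  qed
  moreover have "inj_on g (ball 0 1)"
  proof (rule inj_onI)
    fix z u assume zu: "z \<in> ball 0 1" "u \<in> ball 0 1" "g z = g u"
    then have "\<phi> (r * z) = \<phi> (r * u)" by (simp add: g_def)
    then have "complex_of_real r * z = r * u" using rz[OF zu(1)] rz[OF zu(2)] inv by (metis imageE)
    then show "z = u" using r by simp
  qed
  moreover have "g z \<noteq> 0" if "z \<in> ball 0 1" for z
    using rz[OF that] inv w by (auto simp: g_def)
  ultimately have "cmod (deriv g 0) \<le> 4 * cmod (g 0)" by (rule koebe_quarter_nonvanishing)
  moreover have "g 0 = x - w" using inv[OF assms(2)] f(3) by (simp add: g_def)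
  moreover have "deriv g 0 = r * deriv \<phi> 0"
  proof (rule DERIV_imp_deriv)
    have "(\<phi> has_field_derivative deriv \<phi> 0) (at (complex_of_real r * 0))"
      using holomorphic_derivI[OF \<phi> op rz[of 0]] by simp
    then have "((\<lambda>z. \<phi> (r * z)) has_field_derivative deriv \<phi> 0 * r) (at 0)"
      by (rule DERIV_chain2) (auto intro!: derivative_eq_intros)
    then show "(g has_field_derivative r * deriv \<phi> 0) (at 0)"
      unfolding g_def by (auto intro!: derivative_eq_intros simp: mult.commute)
  qed
  ultimately have "r * cmod (deriv \<phi> 0) \<le> 4 * cmod (x - w)" using r by (simp add: norm_mult)
  then have "r * cmod (deriv \<phi> 0) * cmod (deriv f x) \<le> 4 * cmod (x - w) * cmod (deriv f x)"
    by (rule mult_right_mono) simp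
  moreover have "cmod (deriv f x) * cmod (deriv \<phi> 0) = 1"
    using d[OF assms(2)] f(3) by (metis norm_mult norm_one)
  then have "r * cmod (deriv \<phi> 0) * cmod (deriv f x) = r"
    by (simp add: mult_ac)
  ultimately show ?thesis by simp
qed

subsection \<open>Squeezing function and Caratheodory norm\<close>

text \<open>Cauchy's estimate on a closed disc inside \<open>D\<close> applies to all competitors at
  once. Boundedness is what lets a single competitor be compared with the real supremum.\<close>

lemma bdd_above_disc_maps_deriv:
  assumes "open D" "x \<in> D"
  shows "bdd_above ((\<lambda>f. cmod (deriv f x)) ` disc_maps D x)"
proof -
  obtain e where e: "e > 0" "cball x e \<subseteq> D" using assms open_contains_cball by blast
  have "cmod (deriv f x) \<le> 1 / e" if "f \<in> disc_maps D x" for f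
  proof -
    have hol: "f holomorphic_on cball x e" and f: "\<And>z. z \<in> D \<Longrightarrow> cmod (f z) < 1"
      using that e by (auto simp: disc_maps_def intro: holomorphic_on_subset)
    have "cmod ((deriv ^^ 1) f x) \<le> fact 1 * 1 / e ^ 1"
    proof (rule Cauchy_inequality)
      show "cmod (f z) \<le> 1" if "cmod (x - z) = e" for z
        using that e by (intro less_imp_le f) (auto simp: dist_norm)
    qed (use hol e holomorphic_on_subset[OF hol ball_subset_cball] holomorphic_on_imp_continuous_on in auto)
    then show ?thesis by simp
  qed
  then show ?thesis by (rule bdd_aboveI2)
qed

lemma injective_disc_map_exists:
  assumes "bounded D"
  shows "\<exists>f \<in> disc_maps D x. inj_on f D"
proof -
  obtain B where B: "B > 0" "\<And>z. z \<in> D \<Longrightarrow> cmod (z - x) < B"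
  proof -
    obtain e where e: "\<And>z. z \<in> D \<Longrightarrow> dist x z \<le> e"
      using assms bounded_any_center[of D x] by blast
    show thesis
      \<comment> \<open>This choice makes the bound strict, so the scaled image stays in the open
        disc, and positive whatever the sign of \<open>e\<close>.\<close>
      by (rule that[of "\<bar>e\<bar> + 1"]) (use e in \<open>force simp: dist_norm norm_minus_commute\<close>)+
  qed
  show ?thesis
  proof (intro bexI)
    show "inj_on (\<lambda>z. (z - x) / B) D" using B by (auto simp: inj_on_def)
    show "(\<lambda>z. (z - x) / B) \<in> disc_maps D x"
      using B by (auto simp: disc_maps_def norm_divide intro!: holomorphic_intros)
  qed
qed

theorem theorem4p2:
  fixes D :: "complex set" and x :: complex
  assumes "open D" and "connected D" and "bounded D" and "x \<in> D"
  shows "caratheodory_norm D x \<ge> squeezing D x / (4 * infdist x (frontier D))"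
proof -
  \<comment> \<open>A nonempty frontier guarantees that \<open>infdist\<close> is a genuine attained
    distance; for the empty set it would be 0 by convention.\<close>
  have "D \<noteq> UNIV" using assms(3) not_bounded_UNIV by blast
  then have ne: "frontier D \<noteq> {}" using assms(4) frontier_eq_empty by blast
  obtain w where w: "w \<in> frontier D" "infdist x (frontier D) = dist x w"
    using infdist_attains_inf[OF frontier_closed ne] by blast
  have wD: "w \<notin> D" using w(1) assms(1) frontier_disjoint_eq by blast
  define \<delta> where "\<delta> = infdist x (frontier D)"
  have \<delta>: "\<delta> > 0" "\<delta> = cmod (x - w)" using w wD assms(4) by (auto simp: \<delta>_def dist_norm)
  have le: "cmod (deriv f x) \<le> caratheodory_norm D x" if "f \<in> disc_maps D x" for f
    unfolding caratheodory_norm_def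
    by (rule cSUP_upper[OF that bdd_above_disc_maps_deriv[OF assms(1,4)]])
  have "squeezing D x \<le> 4 * \<delta> * caratheodory_norm D x"
    unfolding squeezing_def
  proof (rule cSUP_least)
    show "{f \<in> disc_maps D x. inj_on f D} \<noteq> {}"
      using injective_disc_map_exists[OF assms(3)] by blast
    fix f assume f: "f \<in> {f \<in> disc_maps D x. inj_on f D}"
    show "Sup {r. ball 0 r \<subseteq> f ` D} \<le> 4 * \<delta> * caratheodory_norm D x"
    proof (rule cSup_least)
      \<comment> \<open>Radii \<open>r \<le> 0\<close> belong to this set because their balls are
        empty; they provide nonemptiness and are treated separately below.\<close>
      have "0 \<in> {r. ball 0 r \<subseteq> f ` D}" by simp
      then show "{r. ball 0 r \<subseteq> f ` D} \<noteq> {}" by blast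
      fix r assume "r \<in> {r. ball 0 r \<subseteq> f ` D}"
      then have r: "ball 0 r \<subseteq> f ` D" by simp
      have "r \<le> 4 * \<delta> * cmod (deriv f x)"
      proof (cases "r > 0")
        case True
        then show ?thesis
          unfolding \<delta>(2) using f r wD assms by (intro squeezing_disc_le) (auto simp: disc_maps_def)
      next
        case False
        moreover have "0 \<le> 4 * \<delta> * cmod (deriv f x)" using \<delta>(1) by simp
        ultimately show ?thesis by linarith
      qed
      also have "\<dots> \<le> 4 * \<delta> * caratheodory_norm D x"
        using le f \<delta>(1) by (intro mult_left_mono) auto
      finally show "r \<le> 4 * \<delta> * caratheodory_norm D x" .
    qed
  qed
  then show ?thesis using \<delta>(1) unfolding \<delta>_def[symmetric] by (simp add: field_simps)
qed

end
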